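(* Let $G$ be a strongly regular graph with parameters $(v, k, \lambda, u)$ satisfying $2k - \lambda \neq u + 2$ and $v \neq 2k+1$. Then $G$ can be uniquely reconstructed from $T_3(G)$ given the value of $k$ and the fact that $G$ is strongly regular: if $G'$ is a strongly regular $k$-regular graph on the same vertex set with $T_3(G') = T_3(G)$, then $G' = G$.
   Context: Graphs are finite, simple, labeled; equality of labeled graphs means same vertex set and same edge set. A strongly regular graph with parameters $(v,k,\lambda,u)$ is a $k$-regular graph on $v$ vertices in which every two adjacent vertices have exactly $\lambda$ common neighbors and every two distinct non-adjacent vertices have exactly $u$ common neighbors. $T_3(G) = \{X \subseteq V(G) : |X| = 3 \text{ and the subgraph of } G \text{ induced by } X \text{ is connected}\}$ (the set of connected triples). *)

theory Defs
  imports "Graph_Theory.Graph_Theory"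
begin

text \<open>
  A finite simple labeled graph is a \<open>pair_graph\<close>: a finite vertex set with a symmetric,
  irreflexive set of arcs (each undirected edge is represented by its two arcs). Equality of such
  records is equality of the vertex sets and of the edge sets.
\<close>

definition regular_graph :: "'a pair_pre_digraph \<Rightarrow> nat \<Rightarrow> bool" where
  "regular_graph G k \<longleftrightarrow> pair_graph G \<and> (\<forall>x \<in> pverts G. out_degree G x = k)"

definition common_neighbors :: "'a pair_pre_digraph \<Rightarrow> 'a \<Rightarrow> 'a \<Rightarrow> 'a set" where
  "common_neighbors G x y = {z \<in> pverts G. x \<rightarrow>\<^bsub>G\<^esub> z \<and> y \<rightarrow>\<^bsub>G\<^esub> z}"

text \<open>
  No non-degeneracy is required: complete and edgeless graphs count as strongly regular,
  with \<open>u\<close> respectively \<open>l\<close> then arbitrary.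
\<close>

definition strongly_regular_graph ::
    "'a pair_pre_digraph \<Rightarrow> nat \<Rightarrow> nat \<Rightarrow> nat \<Rightarrow> nat \<Rightarrow> bool" where
  "strongly_regular_graph G v k l u \<longleftrightarrow>
     card (pverts G) = v \<and> regular_graph G k \<and>
     (\<forall>x \<in> pverts G. \<forall>y \<in> pverts G.
        x \<rightarrow>\<^bsub>G\<^esub> y \<longrightarrow> card (common_neighbors G x y) = l) \<and>
     (\<forall>x \<in> pverts G. \<forall>y \<in> pverts G.
        x \<noteq> y \<and> \<not> x \<rightarrow>\<^bsub>G\<^esub> y \<longrightarrow> card (common_neighbors G x y) = u)"

definition connected_triples :: "'a pair_pre_digraph \<Rightarrow> 'a set set" where
  "connected_triples G = {X. X \<subseteq> pverts G \<and> card X = 3 \<and> connected (with_proj G \<restriction> X)}"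

end

theory Submission
  imports Defs
begin

text \<open>
  The number of connected triples containing two given vertices is \<open>2 * k - l - 2\<close> if they are
  adjacent and \<open>u\<close> otherwise. If \<open>G\<close> and \<open>G'\<close> differ, some vertex \<open>x\<close> has different neighborhoods
  in them, of equal size \<open>k\<close>; comparing the counts at a neighbor of \<open>x\<close> lost in \<open>G'\<close> and at one
  gained shows that the two values for \<open>G'\<close> are those for \<open>G\<close> interchanged. As these are distinct,
  adjacency at \<open>x\<close> in \<open>G'\<close> is the complement of that in \<open>G\<close>, whence \<open>v = 2 * k + 1\<close>.
\<close>

text \<open>A walk from \<open>a\<close> to \<open>b \<noteq> a\<close> has a first step; since
  connectivity refers to the symmetric closure, that step may be an arc in either direction.\<close>

lemma connected_no_isolated:
  assumes "connected H" "a \<in> verts H" "b \<in> verts H" "a \<noteq> b"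
  shows "\<exists>c. (a, c) \<in> arcs_ends H \<or> (c, a) \<in> arcs_ends H"
proof -
  have "(a, b) \<in> rtrancl_on (verts H) ((arcs_ends H)\<^sup>s)"
    using assms by (auto simp: connected_conv)
  then show ?thesis
    using \<open>a \<noteq> b\<close> by (cases rule: converse_rtrancl_on_cases) (auto simp: symcl_def)
qed

text \<open>Any two vertices are joined by a walk through the centre \<open>a\<close>.\<close>

lemma connected_star:
  assumes "a \<in> verts H" "\<And>b. b \<in> verts H \<Longrightarrow> b \<noteq> a \<Longrightarrow> (a, b) \<in> arcs_ends H"
  shows "connected H"
proof -
  let ?R = "rtrancl_on (verts H) ((arcs_ends H)\<^sup>s)"
  have "(a, b) \<in> ?R \<and> (b, a) \<in> ?R" if "b \<in> verts H" for b
    using assms that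
    by (cases "b = a") (auto simp: symcl_def intro!: rtrancl_on_into_rtrancl_on[OF rtrancl_on_refl])
  then have "(b, c) \<in> ?R" if "b \<in> verts H" "c \<in> verts H" for b c
    using that by (meson rtrancl_on_trans)
  then show ?thesis
    using assms(1) by (auto simp: connected_conv)
qed

lemma arcs_ends_induce_with_proj:
  "arcs_ends (with_proj G \<restriction> X) = parcs G \<inter> X \<times> X"
  by (auto simp: arcs_ends_conv)

context pair_graph
begin

lemma finite_neighbors: "finite (parcs G `` {x})"
  using pair_finite_arcs by (rule finite_Image)

lemma connected_triplesI:
  assumes "(a, b) \<in> parcs G" "(a, c) \<in> parcs G" "b \<noteq> c"
  shows "{a, b, c} \<in> connected_triples G"
proof -
  have "connected (with_proj G \<restriction> {a, b, c})"
    using assms by (intro connected_star[of a]) (auto simp: arcs_ends_induce_with_proj)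
  then show ?thesis
    using assms no_loops' by (auto simp: connected_triples_def dest: in_arcsD1 in_arcsD2)
qed

lemma connected_triplesD:
  assumes "X \<in> connected_triples G" "a \<in> X"
  shows "\<exists>b \<in> X. (a, b) \<in> parcs G"
proof -
  have "card X = 3" and con: "connected (with_proj G \<restriction> X)"
    using assms by (auto simp: connected_triples_def)
  then have "X \<noteq> {a}" by auto
  then obtain b where "b \<in> X" "b \<noteq> a" using \<open>a \<in> X\<close> by blast
  with connected_no_isolated[OF con, of a b] \<open>a \<in> X\<close> show ?thesis
    by (auto simp: arcs_ends_induce_with_proj dest: arcs_symmetric)
qed

text \<open>Once \<open>x\<close> and \<open>y\<close> are joined, a third vertex yields a connected
  triple exactly when it is not isolated in it. The endpoints must be removed because each lies in
  the neighborhood of the other.\<close>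

lemma connected_triples_adjacent:
  assumes "(x, y) \<in> parcs G"
  shows "{z. {x, y, z} \<in> connected_triples G} = (parcs G `` {x} \<union> parcs G `` {y}) - {x, y}"
proof (intro set_eqI iffI)
  fix z assume "z \<in> {z. {x, y, z} \<in> connected_triples G}"
  then have T: "{x, y, z} \<in> connected_triples G" by simp
  \<comment> \<open>The cardinality rules out the degenerate cases \<open>z = x\<close> and
    \<open>z = y\<close>.\<close>
  then have "card {x, y, z} = 3" by (simp add: connected_triples_def)
  then have "z \<noteq> x" "z \<noteq> y" by (auto simp: card_insert_if split: if_splits)
  with connected_triplesD[OF T, of z]
  show "z \<in> (parcs G `` {x} \<union> parcs G `` {y}) - {x, y}"
    by (auto dest: arcs_symmetric no_loops')
next
  fix z assume "z \<in> (parcs G `` {x} \<union> parcs G `` {y}) - {x, y}"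
  with assms connected_triplesI[of x y z] connected_triplesI[of y x z]
  show "z \<in> {z. {x, y, z} \<in> connected_triples G}"
    by (auto simp: insert_commute dest: arcs_symmetric)
qed

text \<open>Neither \<open>x\<close> nor \<open>y\<close> may be isolated in the triple, and
  \<open>z\<close> is the only neighbor left for either of them.\<close>

lemma connected_triples_nonadjacent:
  assumes "x \<noteq> y" "(x, y) \<notin> parcs G"
  shows "{z. {x, y, z} \<in> connected_triples G} = parcs G `` {x} \<inter> parcs G `` {y}"
proof (intro set_eqI iffI)
  fix z assume "z \<in> {z. {x, y, z} \<in> connected_triples G}"
  then have T: "{x, y, z} \<in> connected_triples G" by simp
  from connected_triplesD[OF T, of x] connected_triplesD[OF T, of y] assms
  show "z \<in> parcs G `` {x} \<inter> parcs G `` {y}"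
    by (auto dest: arcs_symmetric no_loops')
next
  fix z assume "z \<in> parcs G `` {x} \<inter> parcs G `` {y}"
  with assms connected_triplesI[of z x y]
  show "z \<in> {z. {x, y, z} \<in> connected_triples G}"
    by (auto simp: insert_commute dest: arcs_symmetric)
qed

lemma common_neighbors_eq: "common_neighbors G x y = parcs G `` {x} \<inter> parcs G `` {y}"
  by (auto simp: common_neighbors_def dest: in_arcsD2)

lemma out_degree_eq_card_neighbors: "out_degree G x = card (parcs G `` {x})"
proof -
  have "out_arcs G x = Pair x ` (parcs G `` {x})"
    by (auto simp: out_arcs_def)
  then show ?thesis
    by (simp add: out_degree_def card_image inj_on_def)
qed

end

lemma strongly_regular_pair_graph:
  "strongly_regular_graph G v k l u \<Longrightarrow> pair_graph G"
  by (simp add: strongly_regular_graph_def regular_graph_def)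

lemma strongly_regular_card_neighbors:
  assumes "strongly_regular_graph G v k l u" "x \<in> pverts G"
  shows "card (parcs G `` {x}) = k"
  using assms pair_graph.out_degree_eq_card_neighbors[OF strongly_regular_pair_graph[OF assms(1)], of x]
  by (simp add: strongly_regular_graph_def regular_graph_def)

text \<open>Inclusion-exclusion gives the union of the two neighborhoods \<open>2 * k - l\<close>
  elements, two of which are \<open>x\<close> and \<open>y\<close>. The additive form avoids
  truncated subtraction.\<close>

lemma card_connected_triples_adjacent:
  assumes srg: "strongly_regular_graph G v k l u" and xy: "(x, y) \<in> parcs G"
  shows "card {z. {x, y, z} \<in> connected_triples G} + l + 2 = 2 * k"
proof -
  interpret pair_graph G using srg by (rule strongly_regular_pair_graph)
  let ?N = "\<lambda>x. parcs G `` {x}"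
  have V: "x \<in> pverts G" "y \<in> pverts G" using xy by (auto dest: in_arcsD1 in_arcsD2)
  have l: "card (?N x \<inter> ?N y) = l"
    using srg V xy by (simp add: strongly_regular_graph_def common_neighbors_eq)
  have "{x, y} \<subseteq> ?N x \<union> ?N y" using xy by (auto dest: arcs_symmetric)
  then have "card (?N x \<union> ?N y - {x, y}) + card {x, y} = card (?N x \<union> ?N y)"
    by (metis card_Diff_subset card_mono finite_UnI finite.emptyI finite.insertI finite_neighbors
        le_add_diff_inverse2)
  moreover have "card {x, y} = 2" using no_loops'[OF xy] by simp
  moreover have "card (?N x \<union> ?N y) + l = k + k"
    using card_Un_Int[OF finite_neighbors finite_neighbors, of x y] l
      strongly_regular_card_neighbors[OF srg] V by simp
  ultimately show ?thesis by (simp add: connected_triples_adjacent[OF xy])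
qed

lemma card_connected_triples_nonadjacent:
  assumes srg: "strongly_regular_graph G v k l u"
    and "x \<in> pverts G" "y \<in> pverts G" "x \<noteq> y" "(x, y) \<notin> parcs G"
  shows "card {z. {x, y, z} \<in> connected_triples G} = u"
proof -
  interpret pair_graph G using srg by (rule strongly_regular_pair_graph)
  show ?thesis
    using assms by (simp add: connected_triples_nonadjacent strongly_regular_graph_def
        common_neighbors_eq)
qed

lemma strongly_regular_same_triples_neighbors:
  assumes G: "strongly_regular_graph G v k l u"
    and G': "strongly_regular_graph G' v' k l' u'"
    and V: "pverts G' = pverts G"
    and T: "connected_triples G' = connected_triples G"
    and ne: "2 * int k - int l \<noteq> int u + 2"
    and v: "v \<noteq> 2 * k + 1"
    and x: "x \<in> pverts G"
  shows "parcs G' `` {x} = parcs G `` {x}"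
proof (rule ccontr)
  interpret G: pair_graph G using G by (rule strongly_regular_pair_graph)
  interpret G': pair_graph G' using G' by (rule strongly_regular_pair_graph)
  let ?N = "parcs G `` {x}" and ?N' = "parcs G' `` {x}"
  \<comment> \<open>This count depends on the triples alone, so by \<open>T\<close> it can be
    evaluated in either graph.\<close>
  let ?c = "\<lambda>y. card {z. {x, y, z} \<in> connected_triples G}"
  assume neq: "?N' \<noteq> ?N"
  have k: "card ?N = k" "card ?N' = k"
    using strongly_regular_card_neighbors[OF G] strongly_regular_card_neighbors[OF G'] x V by auto
  \<comment> \<open>Distinct finite sets of equal size cannot contain one another.\<close>
  have "\<not> ?N \<subseteq> ?N'" "\<not> ?N' \<subseteq> ?N"
    using neq k by (metis card_subset_eq G.finite_neighbors G'.finite_neighbors)+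
  then obtain p q where p: "p \<in> ?N" "p \<notin> ?N'" and q: "q \<in> ?N'" "q \<notin> ?N" by blast
  have adj: "?c y + l + 2 = 2 * k" if "y \<in> ?N" for y
    using card_connected_triples_adjacent[OF G, of x y] that by simp
  have adj': "?c y + l' + 2 = 2 * k" if "y \<in> ?N'" for y
    using card_connected_triples_adjacent[OF G', of x y] that T by simp
  have nonadj: "?c y = u" if "y \<in> pverts G - {x} - ?N" for y
    using card_connected_triples_nonadjacent[OF G, of x y] that x by auto
  have nonadj': "?c y = u'" if "y \<in> pverts G - {x} - ?N'" for y
    using card_connected_triples_nonadjacent[OF G', of x y] that x T V by auto
  have N: "?N \<subseteq> pverts G - {x}" "?N' \<subseteq> pverts G - {x}"
    using V by (auto dest: G.in_arcsD2 G'.in_arcsD2 G.no_loops' G'.no_loops')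
  \<comment> \<open>The pair \<open>x\<close>, \<open>p\<close> is an edge only in \<open>G\<close>,
    and \<open>x\<close>, \<open>q\<close> only in \<open>G'\<close>; each equation equates the two
    evaluations of the count at one of these vertices.\<close>
  have swap: "u' + l + 2 = 2 * k" "u + l' + 2 = 2 * k"
    using adj[of p] nonadj'[of p] adj'[of q] nonadj[of q] p q N by auto
  have "y \<in> ?N' \<longleftrightarrow> y \<notin> ?N" if "y \<in> pverts G - {x}" for y
  proof (cases "y \<in> ?N")
    case True
    then have "?c y + l + 2 = 2 * k" by (rule adj)
    \<comment> \<open>Equality would force \<open>l = l'\<close>, and \<open>swap\<close> would then
      give \<open>2 * k = u + l + 2\<close>, against \<open>ne\<close>.\<close>
    then have "?c y + l' + 2 \<noteq> 2 * k" using swap ne by linarith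
    with adj'[of y] True show ?thesis by blast
  next
    case False
    with that nonadj[of y] have "?c y = u" by blast
    then have "?c y \<noteq> u'" using swap ne by linarith
    with nonadj'[of y] that False show ?thesis by blast
  qed
  then have compl: "?N' = pverts G - {x} - ?N" using N by blast
  have "card (pverts G - {x} - ?N) = card (pverts G - {x}) - card ?N"
    using G.finite_neighbors N(1) by (rule card_Diff_subset)
  \<comment> \<open>This bound keeps the natural-number difference above from being
    truncated.\<close>
  moreover have "card ?N \<le> card (pverts G - {x})"
    using N(1) G.pair_finite_verts by (intro card_mono) auto
  moreover have "card (pverts G) = Suc (card (pverts G - {x}))"
    using G.pair_finite_verts x by (rule card.remove)
  ultimately have "card (pverts G) = 2 * k + 1"
    using compl k by simp
  with G v show False by (simp add: strongly_regular_graph_def)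
qed

theorem theorem2p5:
  fixes G :: "'a pair_pre_digraph" and v k l u :: nat
  assumes "strongly_regular_graph G v k l u"
    and "2 * int k - int l \<noteq> int u + 2"
    and "v \<noteq> 2 * k + 1"
  shows "\<forall>G' :: 'a pair_pre_digraph.
           (\<exists>v' l' u'. strongly_regular_graph G' v' k l' u') \<and> pverts G' = pverts G \<and>
           connected_triples G' = connected_triples G \<longrightarrow> G' = G"
proof (intro allI impI, elim conjE exE)
  fix G' :: "'a pair_pre_digraph" and v' l' u'
  assume G': "strongly_regular_graph G' v' k l' u'"
    and V: "pverts G' = pverts G"
    and T: "connected_triples G' = connected_triples G"
  interpret G: pair_graph G using assms(1) by (rule strongly_regular_pair_graph)
  interpret G': pair_graph G' using G' by (rule strongly_regular_pair_graph)
  have "parcs G' `` {x} = parcs G `` {x}" if "x \<in> pverts G" for x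
    using assms G' V T that by (intro strongly_regular_same_triples_neighbors)
  \<comment> \<open>Every arc of either graph starts in the common vertex set, so the neighborhoods
    of vertices determine all arcs.\<close>
  then have "parcs G' = parcs G"
    using V by (auto dest: G.in_arcsD1 G'.in_arcsD1)
  with V show "G' = G" by simp
qed

end
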